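(* Let $G$ be a connected graph on $n \geq 3$ vertices with constant resistance curvature, and let $\mathcal{K}_G$ denote the common value of the resistance curvature at its vertices. Then $$\mathcal{K}_G \geq \frac{6}{n^2-1},$$ with equality if and only if $G = C_n$, the cycle on $n$ vertices.
   Context: All graphs are finite, simple and undirected. For a connected graph $G$ and vertices $i,j$, the resistance distance $\Omega_G(i,j)$ is the effective resistance between $i$ and $j$ in the electrical network obtained from $G$ by replacing each edge with a unit resistor. The resistance matrix $R_G$ is the $n\times n$ matrix with $(i,j)$-entry $\Omega_G(i,j)$; it is nonsingular. The resistance curvature vector $\kappa=(\kappa_1,\dots,\kappa_n)^T$ is the unique solution of $R_G\kappa=\mathbf{1}$, where $\mathbf{1}$ is the all-ones vector. $G$ has constant resistance curvature if all $\kappa_i$ are equal; this common value is denoted $\mathcal{K}_G$. *)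

theory Defs
  imports Complex_Main "Graph_Theory.Graph_Theory"
begin

text \<open>
  A finite simple undirected graph is a \<^locale>\<open>pair_graph\<close>: every edge is represented by
  its two orientations.
\<close>

text \<open>
  Potentials \<open>x\<close> realizing a unit current from \<open>i\<close> to \<open>j\<close> when every edge is a unit resistor:
  by Ohm's law the current along \<open>(u, w)\<close> is \<open>x u - x w\<close>, and by Kirchhoff's current law the
  net current leaving \<open>u\<close> is the external current injected at \<open>u\<close>.
\<close>

definition unit_current_potential ::
    "'a pair_pre_digraph \<Rightarrow> 'a \<Rightarrow> 'a \<Rightarrow> ('a \<Rightarrow> real) \<Rightarrow> bool" where
  "unit_current_potential G i j x \<longleftrightarrow>
     (\<forall>u\<in>pverts G. (\<Sum>w | (u, w) \<in> parcs G. x u - x w) = of_bool (u = i) - of_bool (u = j))"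

text \<open>
  On a connected graph such a potential exists and is unique up to an additive constant, so the
  description determines a unique value for \<open>i\<close>, \<open>j\<close> in \<open>pverts G\<close>.
\<close>

definition resistance_distance :: "'a pair_pre_digraph \<Rightarrow> 'a \<Rightarrow> 'a \<Rightarrow> real" where
  "resistance_distance G i j = (THE r. \<exists>x. unit_current_potential G i j x \<and> r = x i - x j)"

text \<open>
  The resistance matrix is \<^const>\<open>resistance_distance\<close> restricted to \<open>pverts G \<times> pverts G\<close>, and
  vectors are functions on \<open>pverts G\<close>, set to zero elsewhere to make the solution unique.
\<close>

definition resistance_curvature :: "'a pair_pre_digraph \<Rightarrow> 'a \<Rightarrow> real" where
  "resistance_curvature G =
     (THE \<kappa>. (\<forall>i\<in>pverts G. (\<Sum>j\<in>pverts G. resistance_distance G i j * \<kappa> j) = 1) \<and>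
             (\<forall>i. i \<notin> pverts G \<longrightarrow> \<kappa> i = 0))"

definition constant_resistance_curvature :: "'a pair_pre_digraph \<Rightarrow> bool" where
  "constant_resistance_curvature G \<longleftrightarrow>
     (\<exists>c. \<forall>v\<in>pverts G. resistance_curvature G v = c)"

definition common_resistance_curvature :: "'a pair_pre_digraph \<Rightarrow> real" where
  "common_resistance_curvature G = (THE c. \<forall>v\<in>pverts G. resistance_curvature G v = c)"

text \<open>This is a simple cycle only for \<open>n \<ge> 3\<close>.\<close>

definition cycle_graph :: "nat \<Rightarrow> nat pair_pre_digraph" where
  "cycle_graph n =
     \<lparr> pverts = {..<n},
       parcs = {(i, j). i < n \<and> j < n \<and> (j = (i + 1) mod n \<or> i = (j + 1) mod n)} \<rparr>"

end

theory Submission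
  imports Defs "Jordan_Normal_Form.Determinant"
begin

text \<open>
  Let \<open>g\<^sub>i\<close> be the potential of mean zero for a unit current entering at \<open>i\<close> and leaving uniformly
  through all \<open>n\<close> vertices. Then \<open>\<Omega>(i,j) = g\<^sub>i(i) + g\<^sub>j(j) - 2 g\<^sub>i(j)\<close>, and the curvature is constant
  iff \<open>g\<^sub>i(i)\<close> does not depend on \<open>i\<close>; its value is then \<open>1 / (2 n g\<^sub>i(i))\<close>.

  Constant curvature excludes cut vertices: if \<open>z\<close> separates off a part \<open>P\<close> with \<open>2 |P| < n\<close>, the
  resistances from \<open>z\<close> to its \<open>d\<close> neighbours in \<open>P\<close> add up to \<open>2 |P| / n < 1\<close>, although each of them
  is at least \<open>1 / d\<close>.

  Now sort the values of \<open>g\<^sub>i\<close> as \<open>X\<^sub>0 \<ge> X\<^sub>1 \<ge> \<dots>\<close>. The cut below the top \<open>k\<close> vertices carries a current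
  of at most \<open>(n - k) / n\<close>, and in the absence of cut vertices two edges across it have a total
  potential drop of at least \<open>X\<^sub>k\<^sub>-\<^sub>2 + X\<^sub>k\<^sub>-\<^sub>1 - X\<^sub>k - X\<^sub>k\<^sub>+\<^sub>1\<close>. Summing this over odd \<open>k\<close> gives
  \<open>X\<^sub>2\<^sub>m\<^sub>-\<^sub>1 + X\<^sub>2\<^sub>m \<ge> 2 X\<^sub>0 - m (n - m) / n\<close> and hence \<open>n g\<^sub>i(i) \<le> (n\<^sup>2 - 1) / 12\<close>. Equality forces the
  first cut to be tight, so that \<open>i\<close> has degree two.
\<close>

section \<open>Linear systems, the summation estimate, and cycle graphs up to relabelling\<close>

text \<open>A trivial kernel makes the determinant nonzero, hence the matrix invertible; the
  enumeration \<open>h\<close> carries the system indexed by \<open>S\<close> over to matrices. It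
  is applied to the Poisson equation and to the curvature vector.\<close>

lemma linear_system_solvable:
  fixes A :: "'a \<Rightarrow> 'a \<Rightarrow> real"
  assumes fin: "finite S"
    and ker: "\<And>x. (\<And>i. i \<in> S \<Longrightarrow> (\<Sum>j\<in>S. A i j * x j) = 0) \<Longrightarrow> \<forall>j\<in>S. x j = 0"
  shows "\<exists>x. \<forall>i\<in>S. (\<Sum>j\<in>S. A i j * x j) = b i"
proof -
  define n where "n = card S"
  obtain h where h: "bij_betw h {0..<n} S"
    using ex_bij_betw_nat_finite[OF fin] unfolding n_def by blast
  define h' where "h' = the_inv_into {0..<n} h"
  have h'h: "h' (h k) = k" if "k < n" for k
    using that h by (simp add: h'_def bij_betw_def the_inv_into_f_f)
  have hS: "h k \<in> S" if "k < n" for k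
    using that h by (auto simp: bij_betw_def)
  have hsurj: "\<exists>k<n. i = h k" if "i \<in> S" for i
    using that h by (auto simp: bij_betw_def)
  define M where "M = mat n n (\<lambda>(i, j). A (h i) (h j))"
  have M: "M \<in> carrier_mat n n" by (simp add: M_def)
  have mult: "(M *\<^sub>v v) $ k = (\<Sum>j\<in>S. A (h k) j * v $ (h' j))"
    if "k < n" "v \<in> carrier_vec n" for k v
  proof -
    have "(M *\<^sub>v v) $ k = (\<Sum>l\<in>{0..<n}. A (h k) (h l) * v $ l)"
      using that by (simp add: M_def scalar_prod_def)
    also have "\<dots> = (\<Sum>l\<in>{0..<n}. A (h k) (h l) * v $ (h' (h l)))"
      by (simp add: h'h)
    also have "\<dots> = (\<Sum>j\<in>S. A (h k) j * v $ (h' j))"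
      by (rule sum.reindex_bij_betw[OF h, where g = "\<lambda>j. A (h k) j * v $ (h' j)"])
    finally show ?thesis .
  qed
  have "det M \<noteq> 0"
  proof
    assume "det M = 0"
    then obtain v where v: "v \<in> carrier_vec n" "v \<noteq> 0\<^sub>v n" "M *\<^sub>v v = 0\<^sub>v n"
      using det_0_iff_vec_prod_zero_field[OF M] by blast
    have "\<forall>j\<in>S. v $ (h' j) = 0"
    proof (rule ker)
      fix i assume "i \<in> S"
      then obtain k where k: "k < n" "i = h k" using hsurj by blast
      then show "(\<Sum>j\<in>S. A i j * v $ (h' j)) = 0"
        using mult[OF k(1) v(1)] v(3) by simp
    qed
    then have "v $ k = 0" if "k < n" for k
      using hS[OF that] h'h[OF that] by force
    then have "v = 0\<^sub>v n" using v(1) by (intro eq_vecI) auto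
    then show False using v(2) by simp
  qed
  then have "M \<in> Units (ring_mat TYPE(real) n ())"
    by (rule det_non_zero_imp_unit[OF M])
  then obtain B where B: "B \<in> carrier_mat n n" "M * B = 1\<^sub>m n"
    by (auto simp: Units_def ring_mat_def)
  define w where "w = B *\<^sub>v vec n (\<lambda>k. b (h k))"
  have w: "w \<in> carrier_vec n" using B by (simp add: w_def)
  have "M *\<^sub>v w = (M * B) *\<^sub>v vec n (\<lambda>k. b (h k))"
    unfolding w_def using assoc_mult_mat_vec[OF M B(1)] by simp
  then have Mw: "M *\<^sub>v w = vec n (\<lambda>k. b (h k))" by (simp add: B)
  have "(\<Sum>j\<in>S. A i j * w $ (h' j)) = b i" if "i \<in> S" for i
  proof -
    obtain k where k: "k < n" "i = h k" using hsurj \<open>i \<in> S\<close> by blast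
    then show ?thesis using mult[OF k(1) w] Mw by simp
  qed
  then show ?thesis by (intro exI[of _ "\<lambda>j. w $ (h' j)"]) auto
qed

lemma sum_times_complement:
  "(\<Sum>m=1..M. real m * (c - real m)) = c * (M * (M + 1) / 2) - M * (M + 1) * (2 * M + 1) / 6"
  by (induction M) (auto simp: field_simps power2_eq_square)

text \<open>Apart from \<open>X 0\<close>, the values are grouped into the pairs
  \<open>X (2 * m - 1)\<close>, \<open>X (2 * m)\<close>, and \<open>bound\<close> is summed over
  \<open>m\<close>. The second summand on the left is the slack of \<open>bound\<close> at
  \<open>m = 1\<close>; it is kept so that equality later forces the first cut to be tight.\<close>

lemma paired_sum_bound:
  fixes X :: "nat \<Rightarrow> real"
  assumes "n \<ge> 3" and last: "X n = X (n - 1)"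
    and bound: "\<And>m. 2 * m \<le> n \<Longrightarrow> 2 * X 0 - (X (2 * m - 1) + X (2 * m)) \<le> m * (real n - m) / n"
  shows "(\<Sum>j<n. X 0 - X j) + ((real n - 1) / n - (2 * X 0 - (X 1 + X 2))) \<le> ((real n)\<^sup>2 - 1) / 12"
proof -
  define D where "D = (\<lambda>m. 2 * X 0 - (X (2 * m - 1) + X (2 * m)))"
  define b where "b = (\<lambda>m. real m * (real n - real m) / n)"
  have Db: "D m \<le> b m" if "2 * m \<le> n" for m using bound[OF that] by (simp add: D_def b_def)
  have odd_sum: "(\<Sum>j<2 * M + 1. X 0 - X j) = (\<Sum>m=1..M. D m)" for M
    by (induction M) (auto simp: D_def)
  have b_sum: "(\<Sum>m=1..M. b m) = (real n * (M * (M + 1) / 2) - M * (M + 1) * (2 * M + 1) / 6) / n" for M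
    unfolding b_def sum_divide_distrib[symmetric] sum_times_complement ..
  have D_sum: "(\<Sum>m=1..M. D m) + (b 1 - D 1) \<le> (\<Sum>m=1..M. b m)" if "2 * M \<le> n" "M \<ge> 1" for M
  proof -
    have split: "(\<Sum>m=1..M. f m) = f 1 + (\<Sum>m=2..M. f m)" for f :: "nat \<Rightarrow> real"
      using that(2) by (simp add: sum.atLeast_Suc_atMost numeral_2_eq_2)
    have "(\<Sum>m=2..M. D m) \<le> (\<Sum>m=2..M. b m)" using that by (intro sum_mono Db) auto
    then show ?thesis unfolding split[of D] split[of b] by simp
  qed
  have "(\<Sum>j<n. X 0 - X j) + (b 1 - D 1) \<le> ((real n)\<^sup>2 - 1) / 12"
  proof (cases "even n")
    case False
    then obtain M where M: "n = 2 * M + 1" by (elim oddE)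
    have "(\<Sum>j<n. X 0 - X j) + (b 1 - D 1) \<le> (\<Sum>m=1..M. b m)"
      unfolding M odd_sum using D_sum[of M] M assms(1) by simp
    also have "\<dots> = ((real n)\<^sup>2 - 1) / 12"
      unfolding b_sum using M by (simp add: field_simps power2_eq_square)
    finally show ?thesis .
  next
    \<comment> \<open>For even \<open>n\<close> the index \<open>n - 1\<close> has no partner.
      Pairing it with the copy \<open>X n = X (n - 1)\<close> counts it twice, so the last pair
      enters with weight one half.\<close>
    case True
    then obtain M where M: "n = 2 * M" by (elim evenE)
    have "(\<Sum>j<2 * M + 1. X 0 - X j) = (\<Sum>j<n. X 0 - X j) + D M / 2"
      using last by (simp add: M D_def)
    moreover obtain L where L: "M = Suc L" "L \<ge> 1" using M assms(1) by (cases M) auto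
    ultimately have "(\<Sum>j<n. X 0 - X j) = (\<Sum>m=1..L. D m) + D M / 2"
      unfolding odd_sum by simp
    also have "\<dots> + (b 1 - D 1) \<le> (\<Sum>m=1..L. b m) + b M / 2"
      using D_sum[of L] Db[of M] M L by simp
    also have "\<dots> = ((real n)\<^sup>2 - 1) / 12"
    proof -
      define r where "r = real M"
      have r: "r > 0" and L_r: "real L = r - 1" and n_r: "real n = 2 * r"
        using L M by (simp_all add: r_def)
      show ?thesis
        unfolding b_sum unfolding b_def using r
        by (simp add: r_def[symmetric] L_r n_r field_simps power2_eq_square)
    qed
    finally show ?thesis by simp
  qed
  then show ?thesis by (simp add: b_def D_def)
qed

text \<open>The predecessor is written \<open>(k + n - 1) mod n\<close> because \<open>k - 1\<close>
  would truncate at \<open>k = 0\<close>. For \<open>n = 2\<close> the two neighbours would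
  coincide.\<close>

lemma cycle_graph_neighbours:
  assumes "k < n" "n \<ge> 3"
  shows "{j. (k, j) \<in> parcs (cycle_graph n)} = {(k + 1) mod n, (k + n - 1) mod n}"
    and "(k + 1) mod n \<noteq> (k + n - 1) mod n"
proof -
  have succ: "(l + 1) mod n = (if l + 1 = n then 0 else l + 1)" if "l < n" for l
    using that by auto
  have pred: "(k + n - 1) mod n = (if k = 0 then n - 1 else k - 1)"
  proof (cases "k = 0")
    case False
    then have "k + n - 1 = (k - 1) + n" by simp
    then have "(k + n - 1) mod n = (k - 1) mod n" by (metis mod_add_self2)
    then show ?thesis using False assms(1) by simp
  qed (use assms in simp)
  show "{j. (k, j) \<in> parcs (cycle_graph n)} = {(k + 1) mod n, (k + n - 1) mod n}"
  proof (rule Set.set_eqI)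
    fix j
    have "j \<in> {j. (k, j) \<in> parcs (cycle_graph n)} \<longleftrightarrow>
        j < n \<and> (j = (k + 1) mod n \<or> k = (j + 1) mod n)"
      using assms(1) by (auto simp: cycle_graph_def)
    also have "\<dots> \<longleftrightarrow> j < n \<and> (j = (if k + 1 = n then 0 else k + 1) \<or>
        k = (if j + 1 = n then 0 else j + 1))"
      using succ[OF assms(1)] succ[of j] by metis
    also have "\<dots> \<longleftrightarrow> j \<in> {(k + 1) mod n, (k + n - 1) mod n}"
      unfolding pred succ[OF assms(1)] using assms by auto
    finally show "j \<in> {j. (k, j) \<in> parcs (cycle_graph n)} \<longleftrightarrow>
        j \<in> {(k + 1) mod n, (k + n - 1) mod n}" .
  qed
  show "(k + 1) mod n \<noteq> (k + n - 1) mod n"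
    unfolding pred succ[OF assms(1)] using assms by auto
qed

text \<open>An arc of \<open>with_proj\<close> is the pair of its ends, so the arc component of an
  isomorphism is determined by the vertex map.\<close>

lemma digraph_iso_with_proj_iff:
  assumes "pair_wf_digraph G"
  shows "digraph_iso (with_proj G) (with_proj H) \<longleftrightarrow>
    (\<exists>f. inj_on f (pverts G) \<and> pverts H = f ` pverts G \<and> parcs H = map_prod f f ` parcs G)"
    (is "?L \<longleftrightarrow> ?R")
proof
  assume ?L
  then obtain h where h: "pre_digraph.digraph_isomorphism (with_proj G) h"
    and H: "with_proj H = app_iso h (with_proj G)"
    by (auto simp: digraph_iso_def)
  let ?f = "iso_verts h"
  have ht: "iso_tail h = fst" "iso_head h = snd"
    and V: "pverts H = ?f ` pverts G" and A: "parcs H = iso_arcs h ` parcs G"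
    using H by (simp_all add: with_proj_def app_iso_def)
  have "iso_arcs h a = map_prod ?f ?f a" if "a \<in> parcs G" for a
    using h that ht by (cases a) (auto simp: pre_digraph.digraph_isomorphism_def prod_eq_iff)
  then have "parcs H = map_prod ?f ?f ` parcs G" unfolding A by (rule image_cong[OF refl])
  then show ?R using h V by (auto simp: pre_digraph.digraph_isomorphism_def)
next
  assume ?R
  then obtain f where f: "inj_on f (pverts G)" "pverts H = f ` pverts G"
    "parcs H = map_prod f f ` parcs G" by blast
  interpret pair_wf_digraph G by fact
  define h where "h = \<lparr>iso_verts = f, iso_arcs = map_prod f f, iso_head = snd, iso_tail = fst\<rparr>"
  have "inj_on (map_prod f f) (parcs G)"
    using f(1) in_arcsD1 in_arcsD2 by (auto simp: inj_on_def)
  then have "pre_digraph.digraph_isomorphism (with_proj G) h"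
    using f(1) assms by (auto simp: pre_digraph.digraph_isomorphism_def h_def wf_digraph_wp_iff)
  moreover have "with_proj H = app_iso h (with_proj G)"
    using f by (simp add: with_proj_def app_iso_def h_def)
  ultimately show ?L unfolding digraph_iso_def by blast
qed

section \<open>Graph Laplacian: energy, flow through cuts, minimum principle\<close>

locale resistor_network = pair_graph G for G :: "'a pair_pre_digraph" +
  assumes connected_network: "Digraph_Component.connected (with_proj G)"
begin

abbreviation "V \<equiv> pverts G"
abbreviation "E \<equiv> parcs G"
abbreviation "n \<equiv> card V"

text \<open>The graph Laplacian: the net current leaving \<open>u\<close> under the potential
  \<open>x\<close>.\<close>

definition lap :: "('a \<Rightarrow> real) \<Rightarrow> 'a \<Rightarrow> real" where
  "lap x u = (\<Sum>w | (u, w) \<in> E. x u - x w)"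

lemma finite_V: "finite V" and finite_E: "finite E"
  by (simp_all add: pair_finite_verts pair_finite_arcs)

lemma E_sym: "(u, w) \<in> E \<Longrightarrow> (w, u) \<in> E"
  using pair_sym_arcs by (auto simp: symmetric_def sym_def)

lemma E_irrefl: "(u, u) \<notin> E"
  using pair_no_loops by force

lemma finite_nbrs [simp]: "finite {w. (u, w) \<in> E}"
proof -
  have "{w. (u, w) \<in> E} \<subseteq> V" using in_arcsD2 by auto
  then show ?thesis using finite_V finite_subset by blast
qed

lemma V_nonempty: "V \<noteq> {}"
  using connected_network
  by (simp add: Digraph_Component.connected_def strongly_connected_def)

lemma n_pos: "n > 0"
  using V_nonempty finite_V by (simp add: card_gt_0_iff)

text \<open>The form in which connectedness is used: induction along a walk starting in
  \<open>S\<close>.\<close>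

lemma adjacency_closed_eq_V:
  assumes "S \<subseteq> V" "S \<noteq> {}" and closed: "\<And>u w. u \<in> S \<Longrightarrow> (u, w) \<in> E \<Longrightarrow> w \<in> S"
  shows "S = V"
proof -
  obtain s where s: "s \<in> S" using assms(2) by blast
  have sc: "strongly_connected (with_proj G)"
    using connected_network pair_sym_arcs symmetric_connected_imp_strongly_connected by blast
  have "v \<in> S" if "v \<in> V" for v
  proof -
    have "s \<rightarrow>\<^sup>*\<^bsub>with_proj G\<^esub> v"
      using sc s assms(1) that by (auto simp: strongly_connected_def)
    then show ?thesis
    proof (induction rule: reachable_induct)
      case base show ?case by (rule s)
    next
      case (step x y) then show ?case using closed by simp
    qed
  qed
  then show ?thesis using assms(1) by blast
qed

lemma lap_linear:
  "lap (\<lambda>u. x u - y u) u = lap x u - lap y u"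
  "lap (\<lambda>u. c * x u) u = c * lap x u"
  "lap (\<lambda>u. \<Sum>j\<in>J. y' j u) u = (\<Sum>j\<in>J. lap (y' j) u)"
proof -
  show "lap (\<lambda>u. x u - y u) u = lap x u - lap y u"
    by (simp add: lap_def sum_subtractf[symmetric] algebra_simps)
  show "lap (\<lambda>u. c * x u) u = c * lap x u"
    by (simp add: lap_def sum_distrib_left algebra_simps)
  show "lap (\<lambda>u. \<Sum>j\<in>J. y' j u) u = (\<Sum>j\<in>J. lap (y' j) u)"
    unfolding lap_def sum_subtractf[symmetric] by (rule sum.swap)
qed

lemma sum_arcs_swap: "(\<Sum>e\<in>E. f (snd e) (fst e)) = (\<Sum>e\<in>E. f (fst e) (snd e))"
  by (rule sum.reindex_bij_witness[where i = prod.swap and j = prod.swap])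
     (auto simp: E_sym)

text \<open>Each edge occurs as two arcs. Averaging the arc sum with its reversal symmetrises it and
  produces the factor one half.\<close>

lemma dirichlet_form:
  "(\<Sum>u\<in>V. y u * lap x u) = (\<Sum>e\<in>E. (y (fst e) - y (snd e)) * (x (fst e) - x (snd e))) / 2"
proof -
  have S: "E = Sigma V (\<lambda>u. {w. (u, w) \<in> E})" using in_arcsD1 by auto
  have "(\<Sum>u\<in>V. y u * lap x u) = (\<Sum>u\<in>V. \<Sum>w | (u, w) \<in> E. y u * (x u - x w))"
    by (simp add: lap_def sum_distrib_left)
  also have "\<dots> = (\<Sum>e\<in>E. y (fst e) * (x (fst e) - x (snd e)))"
    by (subst (2) S, subst sum.Sigma) (auto simp: finite_V case_prod_beta)
  finally have 1: "(\<Sum>u\<in>V. y u * lap x u) = (\<Sum>e\<in>E. y (fst e) * (x (fst e) - x (snd e)))" .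
  also have "\<dots> = (\<Sum>e\<in>E. y (snd e) * (x (snd e) - x (fst e)))"
    using sum_arcs_swap[of "\<lambda>u w. y u * (x u - x w)"] by simp
  finally show ?thesis using 1
    by (simp add: algebra_simps sum.distrib sum_subtractf)
qed

lemma lap_selfadjoint: "(\<Sum>u\<in>V. y u * lap x u) = (\<Sum>u\<in>V. x u * lap y u)"
  unfolding dirichlet_form by (simp add: mult.commute)

lemma lap_nonneg: "(\<Sum>u\<in>V. x u * lap x u) \<ge> 0"
  unfolding dirichlet_form by (simp add: sum_nonneg)

lemma sum_lap: "(\<Sum>u\<in>V. lap x u) = 0"
  using dirichlet_form[of "\<lambda>_. 1" x] by simp

text \<open>This is the Dirichlet form tested against the indicator of \<open>S\<close>: arcs inside
  or outside \<open>S\<close> drop out, and the two orientations of a crossing edge contribute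
  equally, which cancels the one half.\<close>

lemma sum_lap_cut:
  assumes "S \<subseteq> V"
  shows "(\<Sum>u\<in>S. lap x u) = (\<Sum>e | e \<in> E \<and> fst e \<in> S \<and> snd e \<notin> S. x (fst e) - x (snd e))"
proof -
  have "(\<Sum>u\<in>S. lap x u) = (\<Sum>u\<in>V. of_bool (u \<in> S) * lap x u)"
    using assms finite_V by (intro sum.mono_neutral_cong_left) auto
  also have "\<dots> = (\<Sum>e\<in>E. (of_bool (fst e \<in> S) - of_bool (snd e \<in> S)) * (x (fst e) - x (snd e))) / 2"
    by (rule dirichlet_form)
  also have "(\<Sum>e\<in>E. (of_bool (fst e \<in> S) - of_bool (snd e \<in> S)) * (x (fst e) - x (snd e))) =
     (\<Sum>e\<in>E. of_bool (fst e \<in> S \<and> snd e \<notin> S) * (x (fst e) - x (snd e))) +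
     (\<Sum>e\<in>E. of_bool (snd e \<in> S \<and> fst e \<notin> S) * (x (snd e) - x (fst e)))"
    unfolding sum.distrib[symmetric] by (intro sum.cong) auto
  also have "(\<Sum>e\<in>E. of_bool (snd e \<in> S \<and> fst e \<notin> S) * (x (snd e) - x (fst e))) =
     (\<Sum>e\<in>E. of_bool (fst e \<in> S \<and> snd e \<notin> S) * (x (fst e) - x (snd e)))"
    by (rule sum_arcs_swap[of "\<lambda>u w. of_bool (u \<in> S \<and> w \<notin> S) * (x u - x w)"])
  also have "(\<Sum>e\<in>E. of_bool (fst e \<in> S \<and> snd e \<notin> S) * (x (fst e) - x (snd e))) =
      (\<Sum>e | e \<in> E \<and> fst e \<in> S \<and> snd e \<notin> S. x (fst e) - x (snd e))"
    using finite_E by (intro sum.mono_neutral_cong_right) auto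
  finally show ?thesis by simp
qed

text \<open>At a minimiser other than \<open>a\<close> all outgoing currents are nonpositive with
  nonnegative sum, so they vanish and the neighbours are minimisers too. If \<open>a\<close> were
  not a minimiser, the minimisers would thus fill \<open>V\<close>, including
  \<open>a\<close>.\<close>

lemma minimum_principle:
  assumes "a \<in> V" and super: "\<And>u. u \<in> V \<Longrightarrow> u \<noteq> a \<Longrightarrow> lap x u \<ge> 0" and "v \<in> V"
  shows "x a \<le> x v"
proof -
  define m where "m = Min (x ` V)"
  have m: "m \<le> x u" if "u \<in> V" for u using that finite_V by (simp add: m_def)
  have "\<exists>u\<in>V. x u = m"
    using Min_in[of "x ` V"] finite_V V_nonempty unfolding m_def by (metis (no_types, lifting) finite_imageI image_iff image_is_empty)
  moreover have "{u\<in>V. x u = m} = V" if nm: "x a \<noteq> m"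
  proof (rule adjacency_closed_eq_V)
    show "{u\<in>V. x u = m} \<noteq> {}" using calculation by blast
    fix u w assume u: "u \<in> {u\<in>V. x u = m}" and uw: "(u, w) \<in> E"
    have le: "x w' - x u \<ge> 0" if "(u, w') \<in> E" for w'
      using m[of w'] in_arcsD2[OF that] u by auto
    have "lap x u \<ge> 0" using super u nm by auto
    then have "(\<Sum>w | (u, w) \<in> E. x w - x u) \<le> 0"
      unfolding lap_def by (simp add: sum_subtractf)
    then have "(\<Sum>w | (u, w) \<in> E. x w - x u) = 0"
      using le by (intro antisym sum_nonneg) auto
    then have "x w - x u = 0"
      using le uw by (subst (asm) sum_nonneg_eq_0_iff) auto
    then show "w \<in> {u\<in>V. x u = m}" using u in_arcsD2[OF uw] by auto
  qed auto
  ultimately have "x a = m" using assms(1) by blast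
  then show ?thesis using m assms(3) by simp
qed

lemma harmonic_constant:
  assumes "\<And>u. u \<in> V \<Longrightarrow> lap x u = 0" "u \<in> V" "v \<in> V"
  shows "x u = x v"
  using minimum_principle[of u x v] minimum_principle[of v x u] assms by fastforce

section \<open>Green functions and their relation to resistance distance\<close>

text \<open>The Laplacian has the constants as kernel; adding the all-ones matrix removes it.
  Summing the modified equations over \<open>V\<close> shows that the solution has sum zero, so the
  added term disappears again.\<close>

lemma poisson_solvable:
  assumes "(\<Sum>u\<in>V. f u) = 0"
  shows "\<exists>x. (\<forall>u\<in>V. lap x u = f u) \<and> (\<Sum>u\<in>V. x u) = 0"
proof -
  define A where "A = (\<lambda>u w. lap (\<lambda>v. of_bool (v = w)) u + 1)"
  have A: "(\<Sum>w\<in>V. A u w * x w) = lap x u + (\<Sum>w\<in>V. x w)" if "u \<in> V" for x u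
  proof -
    have "lap x u = lap (\<lambda>v. \<Sum>w\<in>V. x w * of_bool (v = w)) u"
      unfolding lap_def using that finite_V by (intro sum.cong) (auto simp: of_bool_def if_distrib in_arcsD2 cong: if_cong)
    also have "\<dots> = (\<Sum>w\<in>V. x w * lap (\<lambda>v. of_bool (v = w)) u)"
      by (simp only: lap_linear)
    finally show ?thesis by (simp add: A_def algebra_simps sum.distrib)
  qed
  have sum0: "(\<Sum>w\<in>V. x w) = 0"
    if "\<And>u. u \<in> V \<Longrightarrow> lap x u + (\<Sum>w\<in>V. x w) = f' u" "sum f' V = 0" for x f'
  proof -
    have "(\<Sum>u\<in>V. lap x u + (\<Sum>w\<in>V. x w)) = (\<Sum>u\<in>V. f' u)"
      using that by (intro sum.cong) auto
    then show ?thesis using n_pos V_nonempty that(2) by (auto simp: sum.distrib sum_lap)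
  qed
  have "\<exists>x. \<forall>u\<in>V. (\<Sum>w\<in>V. A u w * x w) = f u"
  proof (rule linear_system_solvable[OF finite_V])
    fix x assume x: "\<And>u. u \<in> V \<Longrightarrow> (\<Sum>w\<in>V. A u w * x w) = 0"
    then have s0: "(\<Sum>w\<in>V. x w) = 0" using A by (intro sum0[of x "\<lambda>_. 0"]) auto
    then have lap0: "lap x u = 0" if "u \<in> V" for u using A x that by simp
    show "\<forall>j\<in>V. x j = 0"
    proof
      fix j assume j: "j \<in> V"
      have "(\<Sum>w\<in>V. x w) = (\<Sum>w\<in>V. x j)"
        using lap0 harmonic_constant j by (intro sum.cong) auto
      then show "x j = 0" using s0 V_nonempty finite_V by simp
    qed
  qed
  then obtain x where x: "\<forall>u\<in>V. (\<Sum>w\<in>V. A u w * x w) = f u" by blast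
  then have "(\<Sum>w\<in>V. x w) = 0" using A assms by (intro sum0[of x f]) auto
  then show ?thesis using x A by (intro exI[of _ x]) auto
qed

text \<open>On \<open>V\<close>, for a vertex \<open>i\<close>, this is column \<open>i\<close> of
  the Moore-Penrose inverse of the Laplacian. The choice by \<open>SOME\<close> reflects that values
  outside \<open>V\<close> are undetermined.\<close>

definition green :: "'a \<Rightarrow> 'a \<Rightarrow> real" where
  "green i = (SOME g. (\<forall>u\<in>V. lap g u = of_bool (u = i) - 1 / n) \<and> (\<Sum>u\<in>V. g u) = 0)"

lemma green:
  assumes "i \<in> V"
  shows lap_green: "u \<in> V \<Longrightarrow> lap (green i) u = of_bool (u = i) - 1 / n"
    and sum_green: "(\<Sum>u\<in>V. green i u) = 0"
proof -
  have "(\<Sum>u\<in>V. of_bool (u = i) - 1 / real n) = 0"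
    using assms finite_V n_pos V_nonempty by (simp add: sum_subtractf of_bool_def)
  from someI_ex[OF poisson_solvable[OF this]]
  show "u \<in> V \<Longrightarrow> lap (green i) u = of_bool (u = i) - 1 / n" "(\<Sum>u\<in>V. green i u) = 0"
    unfolding green_def by blast+
qed

text \<open>Reproducing property of the Green function: the constant part \<open>1 / n\<close> pairs
  to zero with \<open>y\<close>.\<close>

lemma sum_mult_lap_green:
  assumes "i \<in> V" "(\<Sum>u\<in>V. y u) = 0"
  shows "(\<Sum>u\<in>V. y u * lap (green i) u) = y i"
proof -
  have "(\<Sum>u\<in>V. y u * lap (green i) u) = (\<Sum>u\<in>V. y u * of_bool (u = i)) - (\<Sum>u\<in>V. y u) / n"
    using assms(1) by (simp add: lap_green algebra_simps sum_subtractf sum_divide_distrib)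
  then show ?thesis
    using assms finite_V by (simp add: of_bool_def if_distrib cong: if_cong)
qed

lemma green_sym:
  assumes "i \<in> V" "j \<in> V"
  shows "green i j = green j i"
  using sum_mult_lap_green[OF assms(1) sum_green[OF assms(2)]]
    sum_mult_lap_green[OF assms(2) sum_green[OF assms(1)]]
    lap_selfadjoint[of "green i" "green j"] by simp

text \<open>In \<open>green i - green j\<close> the uniform sinks cancel, leaving a unit current
  from \<open>i\<close> to \<open>j\<close>. Any other such potential differs from it by a harmonic,
  hence constant, function.\<close>

lemma resistance_distance_green:
  assumes "i \<in> V" "j \<in> V"
  shows "resistance_distance G i j = green i i + green j j - 2 * green i j"
  unfolding resistance_distance_def
proof (rule the_equality)
  let ?y = "\<lambda>u. green i u - green j u"
  have y: "lap ?y u = of_bool (u = i) - of_bool (u = j)" if "u \<in> V" for u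
    using assms that by (simp add: lap_linear lap_green)
  show "\<exists>x. unit_current_potential G i j x \<and> green i i + green j j - 2 * green i j = x i - x j"
    using y green_sym[OF assms]
    by (intro exI[of _ ?y]) (simp add: unit_current_potential_def lap_def)
  fix r assume "\<exists>x. unit_current_potential G i j x \<and> r = x i - x j"
  then obtain x where x: "\<And>u. u \<in> V \<Longrightarrow> lap x u = of_bool (u = i) - of_bool (u = j)" "r = x i - x j"
    by (auto simp: unit_current_potential_def lap_def)
  have "x i - ?y i = x j - ?y j"
    by (rule harmonic_constant[of "\<lambda>u. x u - ?y u"]) (auto simp: assms x y lap_linear(1)[of x ?y])
  then show "r = green i i + green j j - 2 * green i j"
    using x(2) green_sym[OF assms] by simp
qed

section \<open>Nonsingularity of the resistance matrix and the meaning of constant curvature\<close>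

lemma zero_energy_harmonic:
  assumes "(\<Sum>u\<in>V. x u * lap x u) = 0"
  shows "lap x u = 0"
proof -
  have "(\<Sum>e\<in>E. (x (fst e) - x (snd e)) * (x (fst e) - x (snd e))) = 0"
    using assms unfolding dirichlet_form by simp
  then have "\<forall>e\<in>E. (x (fst e) - x (snd e)) * (x (fst e) - x (snd e)) = 0"
    by (subst (asm) sum_nonneg_eq_0_iff) (auto simp: finite_E)
  then have "x u - x w = 0" if "(u, w) \<in> E" for w
    using that by force
  then show ?thesis by (simp add: lap_def)
qed

lemma lap_green_combination:
  assumes "(\<Sum>j\<in>V. y j) = 0" "u \<in> V"
  shows "lap (\<lambda>u. \<Sum>j\<in>V. y j * green j u) u = y u"
proof -
  have "lap (\<lambda>u. \<Sum>j\<in>V. y j * green j u) u = (\<Sum>j\<in>V. y j * (of_bool (u = j) - 1 / n))"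
    unfolding lap_linear using assms by (intro sum.cong) (auto simp: lap_green)
  also have "\<dots> = (\<Sum>j\<in>V. y j * of_bool (u = j)) - (\<Sum>j\<in>V. y j) / n"
    by (simp add: algebra_simps sum_subtractf sum_divide_distrib)
  finally show ?thesis
    using assms finite_V by (simp add: of_bool_def if_distrib cong: if_cong)
qed

lemma green_energy:
  "i \<in> V \<Longrightarrow> (\<Sum>u\<in>V. green i u * lap (green i) u) = green i i"
  by (simp add: sum_mult_lap_green sum_green)

text \<open>\<open>green i i\<close> is the energy of \<open>green i\<close>; if it vanished,
  \<open>green i\<close> would be harmonic, although its Laplacian at \<open>i\<close> is
  \<open>1 - 1 / n\<close>.\<close>

lemma green_diag_pos:
  assumes "i \<in> V" "n \<ge> 2"
  shows "green i i > 0"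
proof -
  have "green i i \<noteq> 0"
  proof
    assume "green i i = 0"
    then have "lap (green i) i = 0"
      using assms green_energy by (intro zero_energy_harmonic) simp
    then show False using assms by (simp add: lap_green field_simps)
  qed
  moreover have "green i i \<ge> 0" using lap_nonneg[of "green i"] green_energy[OF assms(1)] by simp
  ultimately show ?thesis by simp
qed

lemma sum_resistance_distance:
  assumes "i \<in> V"
  shows "(\<Sum>j\<in>V. resistance_distance G i j) = n * green i i + (\<Sum>j\<in>V. green j j)"
proof -
  have "(\<Sum>j\<in>V. resistance_distance G i j) = (\<Sum>j\<in>V. green i i + green j j - 2 * green i j)"
    using assms by (intro sum.cong) (auto simp: resistance_distance_green)
  also have "\<dots> = n * green i i + (\<Sum>j\<in>V. green j j) - 2 * (\<Sum>j\<in>V. green i j)"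
    by (simp add: sum.distrib sum_subtractf sum_distrib_left)
  finally show ?thesis using assms by (simp add: sum_green)
qed

text \<open>Terms of the resistance distance that depend on a single index vanish against a vector
  of sum zero. What remains is the Green kernel with factor \<open>- 2\<close>, which is an
  energy.\<close>

lemma resistance_form_negative:
  assumes "(\<Sum>j\<in>V. y j) = 0"
  defines "h \<equiv> \<lambda>u. \<Sum>j\<in>V. y j * green j u"
  shows "(\<Sum>i\<in>V. y i * (\<Sum>j\<in>V. resistance_distance G i j * y j)) = - 2 * (\<Sum>u\<in>V. h u * lap h u)"
proof -
  define C where "C = (\<Sum>j\<in>V. green j j * y j)"
  have "(\<Sum>j\<in>V. resistance_distance G i j * y j) = C - 2 * h i" if "i \<in> V" for i
  proof -
    have "(\<Sum>j\<in>V. resistance_distance G i j * y j) =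
       (\<Sum>j\<in>V. green i i * y j + green j j * y j - 2 * (y j * green j i))"
    proof (intro sum.cong refl)
      fix j assume "j \<in> V"
      with that show "resistance_distance G i j * y j =
          green i i * y j + green j j * y j - 2 * (y j * green j i)"
        using green_sym[of i j] by (simp add: resistance_distance_green algebra_simps)
    qed
    also have "\<dots> = green i i * (\<Sum>j\<in>V. y j) + C - 2 * h i"
      by (simp add: sum.distrib sum_subtractf sum_distrib_left C_def h_def)
    finally show ?thesis using assms(1) by simp
  qed
  then have "(\<Sum>i\<in>V. y i * (\<Sum>j\<in>V. resistance_distance G i j * y j)) = (\<Sum>i\<in>V. y i * (C - 2 * h i))"
    by simp
  also have "\<dots> = C * (\<Sum>i\<in>V. y i) - 2 * (\<Sum>i\<in>V. h i * y i)"
    by (simp add: algebra_simps sum_subtractf sum_distrib_left)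
  also have "(\<Sum>i\<in>V. h i * y i) = (\<Sum>i\<in>V. h i * lap h i)"
    using lap_green_combination[OF assms(1)] by (simp add: h_def)
  finally show ?thesis using assms(1) by simp
qed

lemma resistance_distance_sym:
  "i \<in> V \<Longrightarrow> j \<in> V \<Longrightarrow> resistance_distance G i j = resistance_distance G j i"
  by (simp add: resistance_distance_green green_sym[of i j])

text \<open>
  The resistance form is negative definite on vectors of sum zero, while a kernel vector of
  nonzero sum would make it positive at the projection to that subspace.
\<close>

lemma resistance_matrix_nonsingular:
  assumes "n \<ge> 2" and ker: "\<And>i. i \<in> V \<Longrightarrow> (\<Sum>j\<in>V. resistance_distance G i j * b j) = 0"
  shows "\<forall>j\<in>V. b j = 0"
proof -
  define m where "m = (\<Sum>j\<in>V. b j) / n"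
  \<comment> \<open>\<open>y\<close> is minus the projection of \<open>b\<close> to sum zero. Since
    \<open>b\<close> lies in the kernel, the resistance matrix maps \<open>y\<close> to
    \<open>m\<close> times its vector \<open>r\<close> of positive row sums.\<close>
  define y where "y = (\<lambda>j. m - b j)"
  define h where "h = (\<lambda>u. \<Sum>j\<in>V. y j * green j u)"
  define r where "r = (\<lambda>i. \<Sum>j\<in>V. resistance_distance G i j)"
  have y0: "(\<Sum>j\<in>V. y j) = 0" using n_pos V_nonempty finite_V by (simp add: y_def m_def sum_subtractf)
  have "(\<Sum>i\<in>V. b i * r i) = (\<Sum>i\<in>V. \<Sum>j\<in>V. resistance_distance G j i * b i)"
    unfolding r_def sum_distrib_left
    by (intro sum.cong) (auto simp: resistance_distance_sym mult.commute)
  also have "\<dots> = (\<Sum>j\<in>V. \<Sum>i\<in>V. resistance_distance G j i * b i)" by (rule sum.swap)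
  also have "\<dots> = 0" by (simp add: ker)
  finally have br: "(\<Sum>i\<in>V. b i * r i) = 0" .
  have "(\<Sum>j\<in>V. resistance_distance G i j * y j) = m * r i" if "i \<in> V" for i
    using ker[OF that] by (simp add: y_def r_def algebra_simps sum_subtractf sum_distrib_left)
  then have "(\<Sum>i\<in>V. y i * (\<Sum>j\<in>V. resistance_distance G i j * y j)) = (\<Sum>i\<in>V. y i * (m * r i))"
    by simp
  also have "\<dots> = m\<^sup>2 * (\<Sum>i\<in>V. r i) - m * (\<Sum>i\<in>V. b i * r i)"
    by (simp add: y_def algebra_simps sum_subtractf sum_distrib_left power2_eq_square)
  finally have form: "m\<^sup>2 * (\<Sum>i\<in>V. r i) = - 2 * (\<Sum>u\<in>V. h u * lap h u)"
    using resistance_form_negative[OF y0] br by (simp add: h_def)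
  have "r i > 0" if "i \<in> V" for i
  proof -
    have "(\<Sum>j\<in>V. green j j) \<ge> 0" using green_diag_pos assms(1) by (intro sum_nonneg) (auto intro: less_imp_le)
    moreover have "n * green i i > 0" using green_diag_pos[OF that assms(1)] n_pos by simp
    ultimately show ?thesis unfolding r_def sum_resistance_distance[OF that] by linarith
  qed
  then have rpos: "(\<Sum>i\<in>V. r i) > 0" using V_nonempty finite_V by (intro sum_pos) auto
  have "m\<^sup>2 * (\<Sum>i\<in>V. r i) \<le> 0" using form lap_nonneg[of h] by simp
  then have "m = 0" using rpos by (simp add: mult_le_0_iff)
  then have "(\<Sum>u\<in>V. h u * lap h u) = 0" using form by simp
  then have "lap h j = 0" for j by (rule zero_energy_harmonic)
  then have "y j = 0" if "j \<in> V" for j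
    using lap_green_combination[OF y0 that] by (simp add: h_def)
  then show ?thesis using \<open>m = 0\<close> by (simp add: y_def)
qed

text \<open>Nonsingularity gives existence as well as uniqueness, so the definite description
  denotes the solution.\<close>

lemma resistance_curvature:
  assumes "n \<ge> 2" "i \<in> V"
  shows "(\<Sum>j\<in>V. resistance_distance G i j * resistance_curvature G j) = 1"
proof -
  let ?P = "\<lambda>\<kappa>. (\<forall>i\<in>V. (\<Sum>j\<in>V. resistance_distance G i j * \<kappa> j) = 1) \<and> (\<forall>i. i \<notin> V \<longrightarrow> \<kappa> i = 0)"
  have "\<exists>\<kappa>. \<forall>i\<in>V. (\<Sum>j\<in>V. resistance_distance G i j * \<kappa> j) = 1"
    by (rule linear_system_solvable[OF finite_V]) (rule resistance_matrix_nonsingular[OF assms(1)])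
  then obtain \<kappa> where \<kappa>: "\<forall>i\<in>V. (\<Sum>j\<in>V. resistance_distance G i j * \<kappa> j) = 1" by blast
  have "\<exists>!\<kappa>. ?P \<kappa>"
  proof (rule ex1I)
    show "?P (\<lambda>j. if j \<in> V then \<kappa> j else 0)" using \<kappa> by simp
    fix k' assume l: "?P k'"
    have "\<forall>j\<in>V. k' j - \<kappa> j = 0"
      using l \<kappa> by (intro resistance_matrix_nonsingular[OF assms(1)]) (simp add: algebra_simps sum_subtractf)
    then show "k' = (\<lambda>j. if j \<in> V then \<kappa> j else 0)" using l by (intro ext) simp
  qed
  from theI'[OF this] show ?thesis using assms(2) unfolding resistance_curvature_def by blast
qed

text \<open>Row \<open>j\<close> reads \<open>c * (n * green j j + T) = 1\<close>, where
  \<open>T\<close> is the trace of the Green kernel. Adding all rows gives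
  \<open>2 * c * T = 1\<close>, so the other summand is one half as well.\<close>

lemma constant_curvature_green:
  assumes "n \<ge> 2" "constant_resistance_curvature G" "i \<in> V"
  shows "common_resistance_curvature G * (2 * n * green i i) = 1"
proof -
  obtain c where c: "\<forall>v\<in>V. resistance_curvature G v = c"
    using assms(2) by (auto simp: constant_resistance_curvature_def)
  have common: "common_resistance_curvature G = c"
    unfolding common_resistance_curvature_def using c V_nonempty by (intro the_equality) auto
  define T where "T = (\<Sum>j\<in>V. green j j)"
  have eq: "c * (n * green j j + T) = 1" if "j \<in> V" for j
  proof -
    have "(\<Sum>k\<in>V. resistance_distance G j k * c) = 1"
      using resistance_curvature[OF assms(1) that] c by simp
    then show ?thesis
      unfolding sum_distrib_right[symmetric] sum_resistance_distance[OF that] T_def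
      by (simp add: mult.commute)
  qed
  have "(\<Sum>j\<in>V. c * (n * green j j + T)) = n" using eq by simp
  moreover have "(\<Sum>j\<in>V. c * (n * green j j + T)) = n * (2 * c * T)"
    by (simp add: T_def sum.distrib sum_distrib_left[symmetric] algebra_simps)
  ultimately have "2 * c * T = 1" using V_nonempty finite_V by simp
  then show ?thesis using eq[OF assms(3)] unfolding common by (simp add: algebra_simps)
qed

section \<open>Constant curvature excludes cut vertices\<close>

text \<open>All current between \<open>P\<close> and its complement passes through the edges from
  \<open>z\<close> to \<open>N\<close>. Two currents are compared on these edges: the one of
  \<open>green z\<close>, and a unit current from \<open>z\<close> to a single vertex of
  \<open>N\<close>.\<close>

lemma pendant_part_large:
  assumes diag: "\<And>i. i \<in> V \<Longrightarrow> green i i = t"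
    and P: "P \<subseteq> V - {z}" "P \<noteq> {}" and z: "z \<in> V"
    and closed: "\<And>p w. p \<in> P \<Longrightarrow> (p, w) \<in> E \<Longrightarrow> w \<in> insert z P"
  shows "n \<le> 2 * card P"
proof -
  define N where "N = {a \<in> P. (a, z) \<in> E}"
  define d where "d = real (card N)"
  have finP: "finite P" using P finite_V finite_subset by blast
  then have finN: "finite N" by (simp add: N_def)
  have cut: "(\<Sum>u\<in>P. lap x u) = (\<Sum>a\<in>N. x a - x z)" for x
  proof -
    have "{e. e \<in> E \<and> fst e \<in> P \<and> snd e \<notin> P} = (\<lambda>a. (a, z)) ` N"
      using closed P by (fastforce simp: N_def)
    then show ?thesis using P by (subst sum_lap_cut) (auto simp: sum.reindex inj_on_def)
  qed
  \<comment> \<open>Each vertex of \<open>P\<close> absorbs \<open>1 / n\<close> of the current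
    entering at \<open>z\<close>.\<close>
  have flow: "(\<Sum>a\<in>N. t - green z a) = card P / n"
  proof -
    have "(\<Sum>u\<in>P. lap (green z) u) = (\<Sum>u\<in>P. - 1 / n)"
      using P z by (intro sum.cong) (auto simp: lap_green)
    then have "(\<Sum>a\<in>N. green z a - t) = - (card P / n)"
      using cut[of "green z"] diag[OF z] by simp
    then show ?thesis by (simp add: sum_subtractf)
  qed
  have "card P > 0" using finP P by (simp add: card_gt_0_iff)
  then have "N \<noteq> {}" using flow n_pos by auto
  then have dpos: "d > 0" using finN by (simp add: d_def card_gt_0_iff)
  \<comment> \<open>A unit current from \<open>z\<close> to \<open>a\<close> enters \<open>P\<close>
    through \<open>d\<close> edges. As \<open>a\<close> has the lowest potential, none of them
    carries more than the whole drop from \<open>z\<close> to \<open>a\<close>, which is the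
    resistance \<open>2 * (t - green z a)\<close>.\<close>
  have drop: "1 / d \<le> 2 * (t - green z a)" if a: "a \<in> N" for a
  proof -
    let ?x = "\<lambda>u. green z u - green a u"
    have aV: "a \<in> V" "a \<noteq> z" "a \<in> P" using a P by (auto simp: N_def)
    have lapx: "lap ?x u = of_bool (u = z) - of_bool (u = a)" if "u \<in> V" for u
      using that z aV by (simp add: lap_linear lap_green)
    have min: "?x a \<le> ?x v" if "v \<in> V" for v
      using that aV by (intro minimum_principle[of a ?x]) (auto simp: lapx)
    have "(\<Sum>u\<in>P. lap ?x u) = (\<Sum>u\<in>P. - of_bool (u = a))"
      using P by (intro sum.cong) (auto simp: lapx)
    also have "\<dots> = -1" using aV finP by (simp add: of_bool_def sum_negf)
    finally have "(\<Sum>b\<in>N. ?x b - ?x z) = -1" using cut[of ?x] by simp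
    moreover have "(\<Sum>b\<in>N. ?x a - ?x z) \<le> (\<Sum>b\<in>N. ?x b - ?x z)"
      using min P by (intro sum_mono) (auto simp: N_def)
    ultimately have "d * (?x z - ?x a) \<ge> 1" by (simp add: d_def algebra_simps)
    moreover have "?x z - ?x a = 2 * (t - green z a)"
      using diag z aV green_sym[of a z] by simp
    ultimately have "1 \<le> d * (2 * (t - green z a))" by metis
    then show ?thesis using dpos by (simp add: divide_le_eq mult.commute)
  qed
  have "1 = (\<Sum>a\<in>N. 1 / d)" using dpos by (simp add: d_def)
  also have "\<dots> \<le> (\<Sum>a\<in>N. 2 * (t - green z a))" by (intro sum_mono drop)
  also have "\<dots> = 2 * (card P / n)" unfolding flow[symmetric] by (simp add: sum_distrib_left)
  finally show ?thesis using n_pos by (simp add: field_simps)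
qed

text \<open>Absence of cut vertices, phrased through bipartitions so that it yields crossing edges
  of a cut directly.\<close>

definition two_connected :: bool where
  "two_connected \<longleftrightarrow> (\<forall>z\<in>V. \<forall>P Q. P \<noteq> {} \<longrightarrow> Q \<noteq> {} \<longrightarrow> P \<inter> Q = {} \<longrightarrow> P \<union> Q = V - {z} \<longrightarrow>
     (\<exists>p\<in>P. \<exists>q\<in>Q. (p, q) \<in> E))"

lemma two_connectedD:
  "\<lbrakk>two_connected; z \<in> V; P \<noteq> {}; Q \<noteq> {}; P \<inter> Q = {}; P \<union> Q = V - {z}\<rbrakk>
    \<Longrightarrow> \<exists>p\<in>P. \<exists>q\<in>Q. (p, q) \<in> E"
  unfolding two_connected_def by meson

text \<open>Both sides of a separation would contain at least half of the \<open>n\<close> vertices,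
  but together they have only \<open>n - 1\<close>.\<close>

lemma constant_green_two_connected:
  assumes diag: "\<And>i. i \<in> V \<Longrightarrow> green i i = t"
  shows two_connected
  unfolding two_connected_def
proof (intro ballI allI impI, rule ccontr)
  fix z P Q assume *: "z \<in> V" "P \<noteq> {}" "Q \<noteq> {}" "P \<inter> Q = {}" "P \<union> Q = V - {z}"
    and no: "\<not> (\<exists>p\<in>P. \<exists>q\<in>Q. (p, q) \<in> E)"
  have "n \<le> 2 * card P"
    using * no in_arcsD2 by (intro pendant_part_large[OF diag, of P z]) blast+
  moreover have "n \<le> 2 * card Q"
    using * no in_arcsD2 E_sym by (intro pendant_part_large[OF diag, of Q z]) blast+
  moreover have "card P + card Q = n - 1"
  proof -
    have "finite (P \<union> Q)" using finite_V *(5) by simp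
    then have "card P + card Q = card (P \<union> Q)" using *(4) by (simp add: card_Un_disjoint)
    then show ?thesis using *(1) *(5) finite_V by simp
  qed
  ultimately show False using n_pos by linarith
qed

text \<open>Deleting an only neighbour \<open>w\<close> of \<open>i\<close> would separate
  \<open>i\<close> from the remaining vertices, which exist since \<open>n \<ge> 3\<close>. If
  \<open>i\<close> had no neighbour, any other vertex could serve as \<open>w\<close>.\<close>

lemma min_degree_two:
  assumes two_connected "n \<ge> 3" "i \<in> V"
  shows "card {w. (i, w) \<in> E} \<ge> 2"
proof (rule ccontr)
  assume "\<not> ?thesis"
  then have "card {w. (i, w) \<in> E} \<le> 1" by simp
  have "\<exists>w\<in>V - {i}. {w. (i, w) \<in> E} \<subseteq> {w}"
  proof (cases "{w. (i, w) \<in> E} = {}")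
    case True
    have "V - {i} \<noteq> {}"
    proof
      assume "V - {i} = {}"
      then have "n \<le> card {i}" by (intro card_mono) auto
      then show False using assms(2) by simp
    qed
    then show ?thesis using True by blast
  next
    case False
    then have "card {w. (i, w) \<in> E} > 0" by (simp add: card_gt_0_iff)
    then have "card {w. (i, w) \<in> E} = 1"
      using \<open>card {w. (i, w) \<in> E} \<le> 1\<close> by linarith
    then obtain w where w: "{w. (i, w) \<in> E} = {w}" using card_1_singletonE by blast
    then have "(i, w) \<in> E" by blast
    then have "w \<in> V - {i}" using in_arcsD2 E_irrefl by blast
    then show ?thesis using w by blast
  qed
  then obtain w where w: "w \<in> V" "w \<noteq> i" "{w. (i, w) \<in> E} \<subseteq> {w}" by blast
  have "V - {i, w} \<noteq> {}"
  proof
    assume "V - {i, w} = {}"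
    then have "n \<le> card {i, w}" by (intro card_mono) auto
    then show False using assms(2) w(2) by simp
  qed
  moreover have "{i} \<union> (V - {i, w}) = V - {w}" using assms(3) w by blast
  ultimately have "\<exists>p\<in>{i}. \<exists>q\<in>V - {i, w}. (p, q) \<in> E"
    using w(1) by (intro two_connectedD[OF assms(1)]) auto
  then show False using w(3) by blast
qed

section \<open>Sweep cuts and the bound on the diagonal of the Green function\<close>

lemma decreasing_enumeration:
  fixes x :: "'a \<Rightarrow> real"
  obtains v where "bij_betw v {..<n} V" "\<And>i j. i \<le> j \<Longrightarrow> j < n \<Longrightarrow> x (v j) \<le> x (v i)"
proof -
  obtain xs where xs: "set xs = V" "distinct xs" using finite_distinct_list[OF finite_V] by blast
  define ys where "ys = sort_key (\<lambda>u. - x u) xs"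
  have ys: "set ys = V" "distinct ys" "length ys = n"
    using xs distinct_card[of xs] by (auto simp: ys_def)
  have "sorted (map (\<lambda>u. - x u) ys)" by (simp add: ys_def)
  then have "x (ys ! j) \<le> x (ys ! i)" if "i \<le> j" "j < n" for i j
    using sorted_nth_mono[of "map (\<lambda>u. - x u) ys" i j] that ys(3) by simp
  moreover have "bij_betw ((!) ys) {..<n} V" by (intro bij_betw_nth) (auto simp: ys)
  ultimately show thesis by (intro that[of "(!) ys"]) auto
qed

text \<open>
  Without a cut vertex, every sweep cut is crossed by an edge avoiding the last vertex above it and
  by an edge avoiding the first vertex below it; if these coincide, a second crossing edge remains.
\<close>

lemma sweep_cut_flow:
  assumes two_connected "n \<ge> 3"
    and v: "bij_betw v {..<n} V"
    and dec: "\<And>i j. i \<le> j \<Longrightarrow> j < n \<Longrightarrow> x (v j) \<le> x (v i)"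
    and k: "1 \<le> k" "k < n"
  defines "X \<equiv> \<lambda>j. x (v (min j (n - 1)))"
  shows "X (k - 2) + X (k - 1) - X k - X (k + 1) \<le> (\<Sum>u\<in>v ` {..<k}. lap x u)"
proof -
  define A where "A = v ` {..<k}"
  define C where "C = {e. e \<in> E \<and> fst e \<in> A \<and> snd e \<notin> A}"
  have inj: "v i = v j \<longleftrightarrow> i = j" if "i < n" "j < n" for i j
    using v that by (auto simp: bij_betw_def inj_on_def)
  have vV: "v i \<in> V" if "i < n" for i using v that by (auto simp: bij_betw_def)
  have AV: "A \<subseteq> V" using vV k by (auto simp: A_def)
  have vA: "v i \<in> A \<longleftrightarrow> i < k" if "i < n" for i
    using inj that k by (auto simp: A_def)
  \<comment> \<open>Clipping the index makes \<open>X n = X (n - 1)\<close>, and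
    \<open>k - 2\<close> truncates to 0 at \<open>k = 1\<close>; so the two extreme cuts fit the
    same formula.\<close>
  have X_dec: "X j \<le> X i" if "i \<le> j" for i j using that dec n_pos by (auto simp: X_def min_def)
  have xA: "\<exists>j<k. u = v j" if "u \<in> A" for u using that by (auto simp: A_def)
  have xB: "\<exists>j<n. k \<le> j \<and> u = v j" if u: "u \<in> V - A" for u
  proof -
    have "u \<in> v ` {..<n}" using u v by (simp add: bij_betw_def)
    then obtain j where "j < n" "u = v j" by blast
    then show ?thesis using vA u by (intro exI[of _ j]) auto
  qed
  have vX: "x (v j) = X j" if "j < n" for j
  proof -
    have "min j (n - 1) = j" using that by simp
    then show ?thesis by (simp add: X_def)
  qed
  have top: "X (k - 1) \<le> x (fst e)" and bot: "x (snd e) \<le> X k" if e: "e \<in> C" for e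
  proof -
    obtain a where "a < k" "fst e = v a" using xA e by (auto simp: C_def)
    then show "X (k - 1) \<le> x (fst e)" using X_dec[of a "k - 1"] vX[of a] k by simp
    have "snd e \<in> V - A" using e in_arcsD2[of "fst e" "snd e"] by (auto simp: C_def)
    then obtain b where "b < n" "k \<le> b" "snd e = v b" using xB by blast
    then show "x (snd e) \<le> X k" using X_dec[of k b] vX[of b] by simp
  qed
  have cross: "\<exists>e\<in>C. fst e \<noteq> z \<and> snd e \<noteq> z"
    if z: "z \<in> V" "A - {z} \<noteq> {}" "V - A - {z} \<noteq> {}" for z
  proof -
    have "(A - {z}) \<union> (V - A - {z}) = V - {z}" using AV by blast
    moreover have "(A - {z}) \<inter> (V - A - {z}) = {}" by blast
    ultimately obtain p q where "p \<in> A - {z}" "q \<in> V - A - {z}" "(p, q) \<in> E"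
      using two_connectedD[OF assms(1) z] by blast
    then show ?thesis by (intro bexI[of _ "(p, q)"]) (auto simp: C_def)
  qed
  \<comment> \<open>The indices \<open>a\<close> and \<open>b\<close> witness that both sides of the
    cut survive the deletion of \<open>v l\<close>.\<close>
  have crossv: "\<exists>e\<in>C. fst e \<noteq> v l \<and> snd e \<noteq> v l"
    if "l < n" "a < k" "a \<noteq> l" "k \<le> b" "b < n" "b \<noteq> l" for a b l
  proof (rule cross)
    show "v l \<in> V" using vV that by simp
    show "A - {v l} \<noteq> {}" using inj[of a l] vA[of a] that by auto
    show "V - A - {v l} \<noteq> {}" using inj[of b l] vA[of b] vV[of b] that by auto
  qed
  have ne: "\<exists>e\<in>C. True"
  proof (cases "k = 1")
    case True then show ?thesis using crossv[of 1 0 2] assms(2) by auto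
  next
    case False then show ?thesis using crossv[of 0 1 k] k by auto
  qed
  \<comment> \<open>An edge avoiding \<open>v (k - 1)\<close> has its upper end among the first
    \<open>k - 1\<close> vertices. For \<open>k = 1\<close> any crossing edge will do, since
    \<open>X (k - 2) = X (k - 1)\<close>.\<close>
  obtain e1 where e1: "e1 \<in> C" "X (k - 2) \<le> x (fst e1)"
  proof (cases "k = 1")
    case True then show thesis using ne top that by fastforce
  next
    case False
    then have "\<exists>e\<in>C. fst e \<noteq> v (k - 1) \<and> snd e \<noteq> v (k - 1)"
      using k by (intro crossv[of _ 0 k]) auto
    then obtain e where e: "e \<in> C" "fst e \<noteq> v (k - 1)" by blast
    obtain a where a: "a < k" "fst e = v a" using xA e by (auto simp: C_def)
    then have "a \<noteq> k - 1" using e by auto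
    then have "a \<le> k - 2" using a by simp
    then show thesis using that[of e] e X_dec[of a "k - 2"] vX[of a] a k by simp
  qed
  obtain e2 where e2: "e2 \<in> C" "x (snd e2) \<le> X (k + 1)"
  proof (cases "k = n - 1")
    case True
    then have "X (k + 1) = X k" by (simp add: X_def)
    then show thesis using ne bot that by fastforce
  next
    case False
    then have "\<exists>e\<in>C. fst e \<noteq> v k \<and> snd e \<noteq> v k"
      using k by (intro crossv[of _ 0 "k + 1"]) auto
    then obtain e where e: "e \<in> C" "snd e \<noteq> v k" by blast
    have "snd e \<in> V - A" using e in_arcsD2[of "fst e" "snd e"] by (auto simp: C_def)
    then obtain b where b: "b < n" "k \<le> b" "snd e = v b" using xB by blast
    then have "b \<noteq> k" using e by auto
    then show thesis using that[of e] e X_dec[of "k + 1" b] vX[of b] b by simp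
  qed
  have "\<exists>f1\<in>C. \<exists>f2\<in>C. f1 \<noteq> f2 \<and> X (k - 2) + X (k - 1) - X k - X (k + 1) \<le>
      (x (fst f1) - x (snd f1)) + (x (fst f2) - x (snd f2))"
  proof (cases "e1 = e2")
    case False
    have "X (k - 2) + X (k - 1) - X k - X (k + 1) \<le>
        (x (fst e1) - x (snd e1)) + (x (fst e2) - x (snd e2))"
      using e1 e2 top[of e2] bot[of e1] by linarith
    then show ?thesis
      by (intro bexI[OF _ e1(1)] bexI[OF _ e2(1)] conjI False)
  next
    \<comment> \<open>The single edge \<open>e1\<close> now has a drop of at least
      \<open>X (k - 2) - X (k + 1)\<close>, and any further crossing edge adds at least
      \<open>X (k - 1) - X k\<close>, which gives the same total.\<close>
    case True
    have e1V: "fst e1 \<in> A" "snd e1 \<in> V - A"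
      using e1 in_arcsD2[of "fst e1" "snd e1"] by (auto simp: C_def)
    \<comment> \<open>Delete the end of \<open>e1\<close> on a side with at least two vertices: the
      lower side if \<open>k = 1\<close>, otherwise the upper side.\<close>
    obtain e3 where e3: "e3 \<in> C" "e3 \<noteq> e1"
    proof (cases "k = 1")
      case True
      obtain b where b: "b < n" "k \<le> b" "snd e1 = v b" using xB e1V by blast
      have "\<exists>c. k \<le> c \<and> c < n \<and> c \<noteq> b"
        using True assms(2) by (intro exI[of _ "if b = 1 then 2 else 1"]) auto
      then obtain c where "k \<le> c" "c < n" "c \<noteq> b" by blast
      then show thesis using crossv[of b 0 c] that b k by auto
    next
      case False
      obtain a where a: "a < k" "fst e1 = v a" using xA e1V by blast
      have "\<exists>c<k. c \<noteq> a" using False k by (intro exI[of _ "if a = 0 then 1 else 0"]) auto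
      then obtain c where "c < k" "c \<noteq> a" by blast
      then show thesis using crossv[of a c k] that a k by auto
    qed
    have "X (k - 2) + X (k - 1) - X k - X (k + 1) \<le>
        (x (fst e1) - x (snd e1)) + (x (fst e3) - x (snd e3))"
      using e1(2) e2(2)[folded True] top[OF e3(1)] bot[OF e3(1)] by linarith
    then show ?thesis
      by (intro bexI[OF _ e1(1)] bexI[OF _ e3(1)] conjI e3(2)[symmetric])
  qed
  then obtain f1 f2 where f: "f1 \<in> C" "f2 \<in> C" "f1 \<noteq> f2"
    "X (k - 2) + X (k - 1) - X k - X (k + 1) \<le> (x (fst f1) - x (snd f1)) + (x (fst f2) - x (snd f2))"
    by blast
  note f(4)
  also have "(x (fst f1) - x (snd f1)) + (x (fst f2) - x (snd f2)) =
      (\<Sum>e\<in>{f1, f2}. x (fst e) - x (snd e))" using f(3) by simp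
  also have "\<dots> \<le> (\<Sum>e\<in>C. x (fst e) - x (snd e))"
  proof (rule sum_mono2)
    show "finite C" using finite_E by (simp add: C_def)
    show "{f1, f2} \<subseteq> C" using f by simp
    fix e assume "e \<in> C - {f1, f2}"
    then show "x (fst e) - x (snd e) \<ge> 0" using top[of e] bot[of e] X_dec[of "k - 1" k] by simp
  qed
  also have "\<dots> = (\<Sum>u\<in>A. lap x u)" unfolding C_def using sum_lap_cut[OF AV] by simp
  finally show ?thesis by (simp add: A_def)
qed

lemma green_diag_bound:
  assumes two_connected "n \<ge> 3" "i \<in> V"
  shows "n * green i i \<le> ((real n)\<^sup>2 - 1) / 12"
    and "n * green i i = ((real n)\<^sup>2 - 1) / 12 \<Longrightarrow> card {w. (i, w) \<in> E} = 2"
proof -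
  define x where "x = green i"
  obtain v where v: "bij_betw v {..<n} V"
    and dec: "\<And>i j. i \<le> j \<Longrightarrow> j < n \<Longrightarrow> x (v j) \<le> x (v i)"
    using decreasing_enumeration[of x] by metis
  define X where "X = (\<lambda>j. x (v (min j (n - 1))))"
  have X_dec: "X j \<le> X i" if "i \<le> j" for i j using that dec n_pos by (auto simp: X_def min_def)
  have vV: "v j \<in> V" if "j < n" for j using v that by (auto simp: bij_betw_def)
  have vsurj: "\<exists>j<n. u = v j" if "u \<in> V" for u using v that by (auto simp: bij_betw_def)
  have vX: "x (v j) = X j" if "j < n" for j
  proof -
    have "min j (n - 1) = j" using that by simp
    then show ?thesis by (simp add: X_def)
  qed
  have flow: "X (k - 2) + X (k - 1) - X k - X (k + 1) \<le> of_bool (i \<in> v ` {..<k}) - k / n"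
    if k: "1 \<le> k" "k < n" for k
  proof -
    have inj: "inj_on v {..<k}" using v k by (auto simp: bij_betw_def intro: inj_on_subset)
    have "(\<Sum>u\<in>v ` {..<k}. lap x u) = (\<Sum>u\<in>v ` {..<k}. of_bool (u = i) - 1 / n)"
      using vV k assms(3) unfolding x_def by (intro sum.cong) (auto simp: lap_green)
    also have "\<dots> = of_bool (i \<in> v ` {..<k}) - card (v ` {..<k}) / n"
      by (simp add: sum_subtractf of_bool_def)
    also have "card (v ` {..<k}) = k" using inj by (simp add: card_image)
    finally have "(\<Sum>u\<in>v ` {..<k}. lap x u) = of_bool (i \<in> v ` {..<k}) - k / n" .
    moreover have "X (k - 2) + X (k - 1) - X k - X (k + 1) \<le> (\<Sum>u\<in>v ` {..<k}. lap x u)"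
      unfolding X_def by (rule sweep_cut_flow[OF assms(1,2) v _ k, where x = x]) (rule dec)
    ultimately show ?thesis by simp
  qed
  \<comment> \<open>The cut at \<open>k = 2 * m + 1\<close> leads from one pair to the next, and the
    terms \<open>1 - (2 * m + 1) / n\<close> add up to \<open>m * (n - m) / n\<close>. At
    \<open>m = 0\<close> the index \<open>2 * m - 1\<close> truncates to 0, so the claim is
    trivial.\<close>
  have bound: "2 * X 0 - (X (2 * m - 1) + X (2 * m)) \<le> m * (real n - m) / n" if "2 * m \<le> n" for m
    using that
  proof (induction m)
    case 0 then show ?case by simp
  next
    case (Suc m)
    have "X (2 * m + 1 - 2) + X (2 * m + 1 - 1) - X (2 * m + 1) - X (2 * m + 1 + 1)
        \<le> of_bool (i \<in> v ` {..<2 * m + 1}) - (2 * m + 1) / n"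
      using Suc.prems by (intro flow[of "2 * m + 1"]) auto
    also have "\<dots> \<le> 1 - real (2 * m + 1) / n" by simp
    finally have "X (2 * m - 1) + X (2 * m) - X (2 * m + 1) - X (2 * m + 2) \<le> 1 - real (2 * m + 1) / n"
      by (cases m) auto
    moreover have "2 * X 0 - (X (2 * m - 1) + X (2 * m)) \<le> m * (real n - m) / n"
      using Suc by simp
    moreover have "m * (c - m) / c + (1 - real (2 * m + 1) / c) = Suc m * (c - Suc m) / c"
      if "c > 0" for c :: real
      using that by (simp add: field_simps)
    then have "m * (real n - m) / n + (1 - real (2 * m + 1) / n) = Suc m * (real n - Suc m) / n"
      using n_pos of_nat_0_less_iff by blast
    ultimately show ?case by simp
  qed
  have total: "(\<Sum>j<n. X 0 - X j) = n * X 0"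
  proof -
    have "(\<Sum>j<n. X j) = (\<Sum>j<n. x (v j))" using vX by simp
    also have "\<dots> = (\<Sum>u\<in>V. x u)" by (rule sum.reindex_bij_betw[OF v])
    also have "\<dots> = 0" unfolding x_def by (rule sum_green[OF assms(3)])
    finally show ?thesis by (simp add: sum_subtractf)
  qed
  have main: "n * X 0 + ((real n - 1) / n - (2 * X 0 - (X 1 + X 2))) \<le> ((real n)\<^sup>2 - 1) / 12"
    using paired_sum_bound[of n X, OF assms(2) _ bound] total by (simp add: X_def)
  have gap: "2 * X 0 - (X 1 + X 2) \<le> (real n - 1) / n"
    using bound[of 1] assms(2) by simp
  have xi: "green i i \<le> X 0"
  proof -
    obtain j where "j < n" "i = v j" using vsurj assms(3) by blast
    then show ?thesis using X_dec[of 0 j] vX[of j] by (simp add: x_def)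
  qed
  then have xi': "n * green i i \<le> n * X 0" by (simp add: mult_left_mono)
  show "n * green i i \<le> ((real n)\<^sup>2 - 1) / 12" using main gap xi' by linarith
  assume "n * green i i = ((real n)\<^sup>2 - 1) / 12"
  then have tight: "2 * X 0 - (X 1 + X 2) = (real n - 1) / n" using main gap xi' by linarith
  \<comment> \<open>Otherwise the current out of the top vertex would be \<open>- 1 / n\<close>,
    whereas \<open>tight\<close> makes the bounded drop positive.\<close>
  have "i = v 0"
  proof (rule ccontr)
    assume "i \<noteq> v 0"
    then have "X 0 + X 0 - X 1 - X 2 \<le> - 1 / n" using flow[of 1] assms(2) by (simp add: numeral_2_eq_2 lessThan_Suc)
    moreover have "(real n - 1) / n > 0" "- 1 / real n \<le> 0" using assms(2) by simp_all
    ultimately show False using tight by linarith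
  qed
  define N where "N = {w. (i, w) \<in> E}"
  have finN: "finite N" by (simp add: N_def)
  have lapi: "(\<Sum>w\<in>N. X 0 - x w) = (real n - 1) / n"
  proof -
    have "lap x i = (real n - 1) / n" 
      using assms(3) V_nonempty finite_V by (simp add: x_def lap_green diff_divide_distrib)
    then show ?thesis using vX[of 0] n_pos by (simp add: lap_def N_def \<open>i = v 0\<close>)
  qed
  have far: "X 0 - X 2 \<le> X 0 - x w" if "w \<in> N" "w \<noteq> v 1" for w
  proof -
    have w: "w \<in> V" "w \<noteq> i" using that in_arcsD2 E_irrefl by (auto simp: N_def)
    then obtain j where j: "j < n" "w = v j" using vsurj by blast
    have "j \<noteq> 0" using w(2) j(2) \<open>i = v 0\<close> by (intro notI) simp
    moreover have "j \<noteq> 1" using that(2) j(2) by (intro notI) simp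
    ultimately have "j \<ge> 2" by simp
    then show ?thesis using X_dec[of 2 j] vX[of j] j by simp
  qed
  \<comment> \<open>Three neighbours would have drops adding up to at least
    \<open>(X 0 - X 1) + 2 * (X 0 - X 2)\<close>, but by \<open>tight\<close> the total is only
    \<open>(X 0 - X 1) + (X 0 - X 2)\<close>. This forces \<open>X 0 = X 1 = X 2\<close> and a total
    of zero.\<close>
  have "card N \<le> 2"
  proof (rule ccontr)
    assume "\<not> card N \<le> 2"
    then have c3: "real (card N) \<ge> 3" by simp
    have X02: "X 0 - X 2 \<ge> 0" "X 1 \<ge> X 2" "X 0 \<ge> X 1" using X_dec by simp_all
    have "(X 0 - X 1) + 2 * (X 0 - X 2) \<le> (\<Sum>w\<in>N. X 0 - x w)"
    proof (cases "v 1 \<in> N")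
      case True
      have "2 * (X 0 - X 2) \<le> (real (card N) - 1) * (X 0 - X 2)"
        using c3 X02 by (intro mult_right_mono) auto
      also have "\<dots> = (\<Sum>w\<in>N - {v 1}. X 0 - X 2)"
        using True finN c3 by (simp add: of_nat_diff)
      also have "\<dots> \<le> (\<Sum>w\<in>N - {v 1}. X 0 - x w)" using far by (intro sum_mono) auto
      also have "\<dots> = (\<Sum>w\<in>N. X 0 - x w) - (X 0 - X 1)"
        using True finN vX[of 1] assms(2) by (simp add: sum_diff1)
      finally show ?thesis by simp
    next
      case False
      have "(X 0 - X 1) + 2 * (X 0 - X 2) \<le> 3 * (X 0 - X 2)" using X02 by simp
      also have "\<dots> \<le> card N * (X 0 - X 2)"
        using c3 X02 by (intro mult_right_mono) auto
      also have "\<dots> = (\<Sum>w\<in>N. X 0 - X 2)" by simp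
      also have "\<dots> \<le> (\<Sum>w\<in>N. X 0 - x w)" using far False by (intro sum_mono) auto
      finally show ?thesis .
    qed
    then have "(X 0 - X 1) + 2 * (X 0 - X 2) \<le> 2 * X 0 - (X 1 + X 2)"
      unfolding lapi tight .
    then have "X 0 = X 2" using X02 by simp
    moreover from this have "X 0 = X 1" using X02 by simp
    moreover have "(real n - 1) / n > 0" using assms(2) by simp
    ultimately show False using tight V_nonempty assms(2) by auto
  qed
  then show "card {w. (i, w) \<in> E} = 2"
    using min_degree_two[OF assms] by (simp add: N_def)
qed

section \<open>The equality case: two-regular graphs and the Green function of the cycle\<close>

text \<open>By maximality, all neighbours of the end \<open>z\<close> of a longest path lie on the
  path. One of them is not the predecessor of \<open>z\<close> and must be the start, so the path
  closes to a cycle; its vertices already have degree two, and connectedness makes it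
  everything.\<close>

lemma two_regular_iso_cycle:
  assumes reg: "\<And>i. i \<in> V \<Longrightarrow> card {w. (i, w) \<in> E} = 2"
  shows "digraph_iso (with_proj G) (with_proj (cycle_graph n))"
proof -
  define path where "path = (\<lambda>xs. xs \<noteq> [] \<and> distinct xs \<and> set xs \<subseteq> V \<and>
    (\<forall>k. Suc k < length xs \<longrightarrow> (xs ! k, xs ! Suc k) \<in> E))"
  obtain s where "s \<in> V" using V_nonempty by blast
  then have "path [s]" by (simp add: path_def)
  moreover have "length xs < Suc n" if "path xs" for xs
    using that card_mono[OF finite_V, of "set xs"] distinct_card[of xs] by (auto simp: path_def)
  ultimately obtain xs where xs: "path xs" and longest: "\<And>ys. path ys \<Longrightarrow> length ys \<le> length xs"
    using ex_has_greatest_nat[of path "[s]" length "Suc n"] by blast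
  define L where "L = length xs"
  have dist: "distinct xs" and xsV: "set xs \<subseteq> V" and "L > 0"
    and step: "Suc k < L \<Longrightarrow> (xs ! k, xs ! Suc k) \<in> E" for k
    using xs by (auto simp: path_def L_def)
  have nth_inj: "xs ! a = xs ! b \<longleftrightarrow> a = b" if "a < L" "b < L" for a b
    using dist that by (simp add: nth_eq_iff_index_eq L_def)
  have nthV: "xs ! a \<in> V" if "a < L" for a using xsV that by (auto simp: L_def)
  have two: "w = p \<or> w = q" if "i \<in> V" "(i, p) \<in> E" "(i, q) \<in> E" "p \<noteq> q" "(i, w) \<in> E" for i p q w
  proof -
    have "{p, q} = {w. (i, w) \<in> E}"
      using that reg[OF that(1)] by (intro card_subset_eq) auto
    then show ?thesis using that(5) by blast
  qed
  define z where "z = xs ! (L - 1)"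
  have z_nbr: "\<exists>a<L - 1. w = xs ! a" if w: "(z, w) \<in> E" for w
  proof -
    have "w \<in> set xs"
    proof (rule ccontr)
      assume nw: "w \<notin> set xs"
      have "path (xs @ [w])"
        unfolding path_def
      proof (intro conjI allI impI)
        show "set (xs @ [w]) \<subseteq> V" using xsV in_arcsD2[OF w] by simp
        fix k assume "Suc k < length (xs @ [w])"
        then have "k < L" by (simp add: L_def)
        then consider "Suc k < L" | "Suc k = L" by linarith
        then show "((xs @ [w]) ! k, (xs @ [w]) ! Suc k) \<in> E"
        proof cases
          case 1 then show ?thesis using step[OF 1] by (simp add: nth_append L_def)
        next
          case 2
          then have "z = xs ! k" by (auto simp: z_def)
          then show ?thesis using 2 w by (simp add: nth_append L_def)
        qed
      qed (use dist nw in auto)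
      then show False using longest[of "xs @ [w]"] by simp
    qed
    then obtain a where a: "a < L" "w = xs ! a" by (auto simp: in_set_conv_nth L_def)
    moreover have "a \<noteq> L - 1" using w E_irrefl a by (auto simp: z_def)
    ultimately show ?thesis by (intro exI[of _ a]) auto
  qed
  have zV: "z \<in> V" unfolding z_def using nthV \<open>L > 0\<close> by simp
  obtain p q where pq: "p \<noteq> q" "(z, p) \<in> E" "(z, q) \<in> E"
    using reg[OF zV] by (auto simp: card_2_iff)
  obtain a b where ab: "a < L - 1" "p = xs ! a" "b < L - 1" "q = xs ! b"
    using z_nbr pq by metis
  have "a \<noteq> b" using ab pq by auto
  then have L3: "L \<ge> 3" using ab by linarith
  obtain c where c: "c < L - 2" "(z, xs ! c) \<in> E"
  proof (cases "a < L - 2")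
    case True then show thesis using that ab pq by blast
  next
    case False
    then have "b < L - 2" using ab \<open>a \<noteq> b\<close> by linarith
    then show thesis using that ab pq by blast
  qed
  \<comment> \<open>An interior \<open>xs ! c\<close> would have three distinct neighbours: its
    predecessor, its successor and \<open>z\<close>.\<close>
  have "c = 0"
  proof (rule ccontr)
    assume "c \<noteq> 0"
    have "(xs ! c, xs ! (c - 1)) \<in> E" using step[of "c - 1"] c \<open>c \<noteq> 0\<close> E_sym by simp
    moreover have "(xs ! c, xs ! Suc c) \<in> E" using step[of c] c by simp
    moreover have "xs ! (c - 1) \<noteq> xs ! Suc c" using nth_inj[of "c - 1" "Suc c"] c by simp
    moreover have "(xs ! c, z) \<in> E" using c E_sym by blast
    ultimately have "z = xs ! (c - 1) \<or> z = xs ! Suc c"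
      using two[of "xs ! c"] nthV[of c] c by auto
    then show False using nth_inj[of "L - 1" "c - 1"] nth_inj[of "L - 1" "Suc c"] c
      by (auto simp: z_def)
  qed
  have succ: "(xs ! k, xs ! ((k + 1) mod L)) \<in> E" if "k < L" for k
  proof (cases "k + 1 = L")
    case True
    then have "k = L - 1" by simp
    then show ?thesis using c \<open>c = 0\<close> True by (simp add: z_def)
  next
    case False
    then show ?thesis using step[of k] that by simp
  qed
  have nbrs: "{w. (xs ! k, w) \<in> E} = (!) xs ` {j. (k, j) \<in> parcs (cycle_graph L)}" if k: "k < L" for k
  proof -
    let ?p = "(k + L - 1) mod L" and ?s = "(k + 1) mod L"
    have lt: "?p < L" "?s < L" using \<open>L > 0\<close> by simp_all
    have "(?p + 1) mod L = (k + L - 1 + 1) mod L" by (rule mod_add_left_eq)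
    also have "\<dots> = k" using k by simp
    finally have "(xs ! k, xs ! ?p) \<in> E" using succ[OF lt(1)] E_sym by simp
    moreover have "(xs ! k, xs ! ?s) \<in> E" by (rule succ[OF k])
    moreover have "xs ! ?s \<noteq> xs ! ?p"
      using nth_inj lt cycle_graph_neighbours(2)[OF k L3] by simp
    ultimately have "{xs ! ?s, xs ! ?p} = {w. (xs ! k, w) \<in> E}"
      using reg[OF nthV[OF k]] by (intro card_subset_eq) auto
    then show ?thesis unfolding cycle_graph_neighbours(1)[OF k L3] by simp
  qed
  have "set xs = V"
  proof (rule adjacency_closed_eq_V[OF xsV])
    show "set xs \<noteq> {}" using \<open>L > 0\<close> by (auto simp: L_def)
    fix u w assume "u \<in> set xs" "(u, w) \<in> E"
    then obtain k where k: "k < L" "u = xs ! k" by (auto simp: in_set_conv_nth L_def)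
    then have "w \<in> (!) xs ` {j. (k, j) \<in> parcs (cycle_graph L)}" using nbrs[of k] \<open>(u, w) \<in> E\<close> by blast
    then show "w \<in> set xs" by (auto simp: cycle_graph_def L_def)
  qed
  then have Ln: "L = n" using dist distinct_card[of xs] by (simp add: L_def)
  have bij: "bij_betw ((!) xs) {..<n} V"
    using dist \<open>set xs = V\<close> Ln by (intro bij_betw_nth) (auto simp: L_def)
  define f where "f = the_inv_into {..<n} ((!) xs)"
  have f_nth: "f (xs ! k) = k" if "k < n" for k
    using bij that by (simp add: f_def bij_betw_def the_inv_into_f_f)
  have f: "bij_betw f V {..<n}" unfolding f_def by (rule bij_betw_the_inv_into[OF bij])
  have "parcs (cycle_graph n) = map_prod f f ` E"
  proof (intro equalityI subsetI)
    fix e assume e: "e \<in> parcs (cycle_graph n)"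
    obtain k j where kj: "e = (k, j)" by (cases e)
    then have lt: "k < n" "j < n" using e by (auto simp: cycle_graph_def)
    then have "(xs ! k, xs ! j) \<in> E" using nbrs[of k] e kj Ln by auto
    then show "e \<in> map_prod f f ` E" using lt kj f_nth by (intro image_eqI[of _ _ "(xs ! k, xs ! j)"]) auto
  next
    fix e assume "e \<in> map_prod f f ` E"
    then obtain u w where uw: "(u, w) \<in> E" "e = (f u, f w)" by auto
    obtain k where k: "k < n" "u = xs ! k" using in_arcsD1[OF uw(1)] bij by (auto simp: bij_betw_def)
    then obtain j where "(k, j) \<in> parcs (cycle_graph n)" "w = xs ! j"
      using nbrs[of k] uw(1) Ln by blast
    moreover from this have "j < n" by (auto simp: cycle_graph_def)
    ultimately show "e \<in> parcs (cycle_graph n)" using uw k f_nth by simp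
  qed
  moreover have "inj_on f V" "pverts (cycle_graph n) = f ` V"
    using f by (auto simp: bij_betw_def cycle_graph_def)
  ultimately show ?thesis
    by (intro iffD2[OF digraph_iso_with_proj_iff[OF pair_wf_digraph_axioms]] exI[of _ f] conjI)
qed

text \<open>For the vertex labelled 0 the Green function is a quadratic polynomial in the label up
  to a constant, and sum zero fixes that constant.\<close>

lemma green_diag_cycle:
  assumes "digraph_iso (with_proj G) (with_proj (cycle_graph n))" "n \<ge> 3"
  shows "\<exists>i\<in>V. n * green i i = ((real n)\<^sup>2 - 1) / 12"
proof -
  obtain f where f: "inj_on f V" "pverts (cycle_graph n) = f ` V" "parcs (cycle_graph n) = map_prod f f ` E"
    using iffD1[OF digraph_iso_with_proj_iff[OF pair_wf_digraph_axioms] assms(1)] by blast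
  have bij: "bij_betw f V {..<n}" using f by (simp add: bij_betw_def cycle_graph_def)
  define N where "N = real n"
  have N: "N \<ge> 3" using assms(2) by (simp add: N_def)
  txt \<open>The second difference of \<open>Y\<close> is constant and \<open>Y 0 = Y n\<close>.\<close>
  define Y where "Y = (\<lambda>k. - (real k * (N - real k)) / (2 * N))"
  have flt: "f u < n" if "u \<in> V" for u using bij that by (auto simp: bij_betw_def)
  have lapY: "lap (\<lambda>u. Y (f u)) u = of_bool (f u = 0) - 1 / N" if u: "u \<in> V" for u
  proof -
    define k where "k = f u"
    have k: "k < n" using flt u by (simp add: k_def)
    have img: "f ` {w. (u, w) \<in> E} = {j. (k, j) \<in> parcs (cycle_graph n)}"
    proof (intro equalityI subsetI)
      fix j assume "j \<in> f ` {w. (u, w) \<in> E}"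
      then show "j \<in> {j. (k, j) \<in> parcs (cycle_graph n)}"
        unfolding f(3) k_def by (force simp: image_iff)
    next
      fix j assume "j \<in> {j. (k, j) \<in> parcs (cycle_graph n)}"
      then obtain u' w where w: "(u', w) \<in> E" "k = f u'" "j = f w" unfolding f(3) by auto
      then have "u' = u" using f(1) u in_arcsD1[OF w(1)] by (auto simp: k_def inj_on_def)
      then show "j \<in> f ` {w. (u, w) \<in> E}" using w by blast
    qed
    have inj: "inj_on f {w. (u, w) \<in> E}"
      using f(1) in_arcsD2 by (auto intro: inj_on_subset)
    have "lap (\<lambda>u. Y (f u)) u = (\<Sum>j\<in>f ` {w. (u, w) \<in> E}. Y k - Y j)"
      unfolding lap_def by (simp add: sum.reindex[OF inj] k_def)
    also have "\<dots> = 2 * Y k - Y ((k + 1) mod n) - Y ((k + n - 1) mod n)"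
      unfolding img cycle_graph_neighbours(1)[OF k assms(2)]
      using cycle_graph_neighbours(2)[OF k assms(2)] by simp
    also have "Y ((k + 1) mod n) = Y (k + 1)"
    proof (cases "k + 1 = n")
      case True
      then have "real k + 1 = N" by (simp add: N_def flip: of_nat_Suc)
      then show ?thesis using True by (simp add: Y_def)
    next
      case False then show ?thesis using k by simp
    qed
    also have "2 * Y k - Y (k + 1) - Y ((k + n - 1) mod n) = of_bool (k = 0) - 1 / N"
    proof (cases "k = 0")
      case True
      have "Y (n - 1) = - ((N - 1) / (2 * N))"
        using assms(2) by (simp add: Y_def N_def of_nat_diff)
      then show ?thesis using True N assms(2) by (simp add: Y_def field_simps)
    next
      case False
      then have "(k + n - 1) mod n = k - 1"
        using k mod_add_self2[of "k - 1" n] by (simp add: Nat.add_diff_assoc2)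
      then show ?thesis using False N by (simp add: Y_def of_nat_diff field_simps)
    qed
    finally show ?thesis by (simp add: k_def)
  qed
  have "0 \<in> f ` V" using bij n_pos by (simp add: bij_betw_def)
  then obtain i where i: "i \<in> V" "f i = 0" by auto
  have "green i i - Y (f i) = green i u - Y (f u)" if "u \<in> V" for u
  proof (rule harmonic_constant[OF _ i(1) that])
    fix w assume w: "w \<in> V"
    have "f w = 0 \<longleftrightarrow> w = i" using f(1) i w by (metis inj_onD)
    then show "lap (\<lambda>u. green i u - Y (f u)) w = 0"
      using lapY[OF w] lap_green[OF i(1) w] by (simp add: lap_linear(1)[of "green i" "\<lambda>u. Y (f u)"] N_def)
  qed
  then have "green i i = green i u - Y (f u)" if "u \<in> V" for u
    using that i by (simp add: Y_def)
  then have "(\<Sum>u\<in>V. green i i) = (\<Sum>u\<in>V. green i u - Y (f u))"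
    by (intro sum.cong) auto
  then have "n * green i i = - (\<Sum>u\<in>V. Y (f u))"
    using sum_green[OF i(1)] by (simp add: sum_subtractf)
  also have "(\<Sum>u\<in>V. Y (f u)) = (\<Sum>k<n. Y k)" by (rule sum.reindex_bij_betw[OF bij])
  \<comment> \<open>\<open>Y\<close> vanishes at 0 and at \<open>n\<close>, so the range can be
    shifted to fit \<open>sum_times_complement\<close>.\<close>
  also have "\<dots> = (\<Sum>k=1..n. Y k)"
  proof (rule sum.mono_neutral_cong)
    fix k assume "k \<in> {..<n} - {1..n}"
    then show "Y k = 0" by (auto simp: Y_def)
  next
    fix k assume "k \<in> {1..n} - {..<n}"
    then show "Y k = 0" by (auto simp: Y_def N_def)
  qed auto
  also have "\<dots> = - (\<Sum>k=1..n. real k * (N - real k)) / (2 * N)"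
    by (simp add: Y_def sum_divide_distrib sum_negf)
  also have "\<dots> = - ((N\<^sup>2 - 1) / 12)"
    unfolding sum_times_complement using N
    by (simp add: N_def[symmetric] field_simps power2_eq_square)
  finally show ?thesis using i by (intro bexI[of _ i]) (auto simp: N_def)
qed

end

section \<open>From the Green function bound to the curvature bound\<close>

theorem theorem2p7:
  fixes G :: "'a pair_pre_digraph" and n :: nat
  assumes "pair_graph G"
    and "Digraph_Component.connected (with_proj G)"
    and "card (pverts G) = n"
    and "n \<ge> 3"
    and "constant_resistance_curvature G"
  shows "common_resistance_curvature G \<ge> 6 / ((real n)\<^sup>2 - 1) \<and>
    (common_resistance_curvature G = 6 / ((real n)\<^sup>2 - 1) \<longleftrightarrow>
      digraph_iso (with_proj G) (with_proj (cycle_graph n)))"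
proof -
  interpret pair_graph G by fact
  interpret resistor_network G by unfold_locales fact
  define c where "c = common_resistance_curvature G"
  define B where "B = ((real n)\<^sup>2 - 1) / 12"
  have "real n * real n \<ge> 3 * 3" using assms(4) by (intro mult_mono) auto
  then have B: "B > 0" by (simp add: B_def power2_eq_square)
  have B': "6 / ((real n)\<^sup>2 - 1) = 1 / (2 * B)"
    using B by (simp add: B_def divide_simps)
  have c: "c * (2 * (n * green i i)) = 1" if "i \<in> pverts G" for i
    using constant_curvature_green[OF _ assms(5) that] assms(3,4) by (simp add: c_def)
  \<comment> \<open>The right-hand side is independent of \<open>i\<close>, which is the hypothesis
    of \<open>constant_green_two_connected\<close>.\<close>
  have "green i i = 1 / (2 * n * c)" if "i \<in> pverts G" for i
  proof -
    have "green i i * (2 * n * c) = 1" using c[OF that] by (simp add: ac_simps)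
    moreover from this have "2 * n * c \<noteq> 0" by (metis mult_zero_right zero_neq_one)
    ultimately show ?thesis by (metis nonzero_eq_divide_eq)
  qed
  then have conn: two_connected by (rule constant_green_two_connected)
  note n3 = assms(4)[folded assms(3)]
  note bound = green_diag_bound[OF conn n3, unfolded assms(3), folded B_def]
  have c_eq: "c = 1 / (2 * (n * green i i))" if "i \<in> pverts G" for i
    using c[OF that] by (metis nonzero_eq_divide_eq mult_zero_right zero_neq_one)
  then have tight: "c = 1 / (2 * B) \<longleftrightarrow> n * green i i = B" if "i \<in> pverts G" for i
    using that by simp
  obtain i where i: "i \<in> pverts G" using V_nonempty by blast
  have g: "n * green i i > 0" using green_diag_pos[OF i] assms(3,4) by simp
  have "1 / (2 * B) \<le> 1 / (2 * (n * green i i))"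
    using bound(1)[OF i] g by (intro divide_left_mono) auto
  also have "\<dots> = c" by (rule c_eq[OF i, symmetric])
  finally have "c \<ge> 1 / (2 * B)" .
  moreover have "c = 1 / (2 * B) \<longleftrightarrow> digraph_iso (with_proj G) (with_proj (cycle_graph n))"
  proof
    assume "c = 1 / (2 * B)"
    then have "card {w. (i, w) \<in> parcs G} = 2" if "i \<in> pverts G" for i
      using bound(2)[OF that] tight[OF that] by blast
    then show "digraph_iso (with_proj G) (with_proj (cycle_graph n))"
      using two_regular_iso_cycle assms(3) by simp
  next
    assume "digraph_iso (with_proj G) (with_proj (cycle_graph n))"
    \<comment> \<open>A single vertex suffices, because \<open>tight\<close> holds at every vertex
      with the same \<open>c\<close>.\<close>
    then obtain j where "j \<in> pverts G" "n * green j j = B"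
      using green_diag_cycle n3 unfolding assms(3) B_def by blast
    then show "c = 1 / (2 * B)" using tight by blast
  qed
  ultimately show ?thesis unfolding c_def B' by blast
qed

end
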